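(* For all $x>0$ the following hold. If $p>1$: $V_m^p(x)\ge (x^p+m+1)^{-\frac{p-1}{p}}$ for all real $m>-1$, and $V_m^p(x)\le (x^p+m)^{-\frac{p-1}{p}}$ for all real $m\ge 0$. If $\frac12\le p<1$: $V_m^p(x)\le (x^p+m+1)^{\frac{1-p}{p}}$ for all real $m>-1$, and $V_m^p(x)\ge (x^p+m)^{\frac{1-p}{p}}$ for all real $m\ge 0$. If $0<p\le\frac12$: $V_m^p(x)\ge (x^p+m+1)^{\frac{1-p}{p}}$ for all real $m>-1$.
   Context: For real $p>0$, real $m>-1$ and $x>0$, $V_m^p(x)=\frac{p e^{x^p}}{\Gamma(m+1)}\int_x^\infty (t^p-x^p)^m e^{-t^p}\,dt=\frac{1}{\Gamma(m+1)}\int_0^\infty \frac{u^m e^{-u}}{(x^p+u)^{(p-1)/p}}\,du$. *)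

theory Defs
  imports "HOL-Analysis.Analysis"
begin

(* V m p x is the function written V with subscript m and superscript p; it is
   meaningful for p > 0, m > -1, x > 0, where the integral converges absolutely.
   The domain is the open half-line, so both bases of powr in the integrand are positive.
   Substituting u = t^p - x^p gives
   V m p x = (1 / Gamma (m+1)) * (integral over u > 0 of u^m e^(-u) / (x^p + u)^((p-1)/p)). *)
definition V :: "real \<Rightarrow> real \<Rightarrow> real \<Rightarrow> real" where
  "V m p x = p * exp (x powr p) / Gamma (m + 1) *
     (LBINT t:{x<..}. (t powr p - x powr p) powr m * exp (- (t powr p)))"

end

theory Submission
  imports Defs
begin

text \<open>
  Write \<open>a = x powr p\<close> and \<open>b = (1 - p) / p\<close>. The substitution \<open>u = t powr p - a\<close> turns
  \<open>V m p x\<close> into the mean of \<open>(a + U) powr b\<close>, where \<open>U\<close> has the Gamma distribution with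
  shape \<open>m + 1\<close> (lemma \<open>V_eq_gamma_mean\<close>), and all five bounds become instances of
  Jensen's inequality.

  Since \<open>U\<close> has mean \<open>m + 1\<close>, comparing the mean of \<open>(a + U) powr b\<close> with
  \<open>(a + m + 1) powr b\<close> only requires the sign of \<open>b * (b - 1)\<close>, which decides whether
  \<open>s \<mapsto> s powr b\<close> is convex or concave. This accounts for the three ranges of \<open>p\<close>:
  \<open>b < 0\<close> for \<open>p > 1\<close>, \<open>0 < b \<le> 1\<close> for \<open>1/2 \<le> p < 1\<close> and \<open>b \<ge> 1\<close> for \<open>p \<le> 1/2\<close>.

  The bounds by \<open>(a + m) powr b\<close> come from applying Jensen's inequality in the
  reciprocal variable, \<open>(a + U) powr b = (1 / (a + U)) powr (- b)\<close>, together with the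
  estimate that \<open>1 / (a + U)\<close> has mean at most \<open>1 / (a + m)\<close>
  (lemma \<open>gamma_mean_reciprocal_le\<close>). The latter is again Jensen's inequality, now for the
  concave function \<open>u / (a + u)\<close> and the Gamma distribution of shape \<open>m\<close>: one factor
  \<open>u\<close> of the density \<open>u powr m * exp (- u)\<close> is moved into the integrand. (For \<open>m = 0\<close> the
  estimate is the pointwise bound \<open>1 / (a + u) \<le> 1 / a\<close>.) Since
  \<open>b + 1 = 1 / p\<close> is positive, the sign of \<open>b\<close> alone decides whether \<open>s powr (- b)\<close> is
  convex or concave, and it also decides whether this power increases or decreases in \<open>s\<close>.
  The two effects agree, so the inequality for the mean of \<open>1 / (a + U)\<close> can be inserted.

  Jensen's inequality is used in its elementary form: a convex function lies above its
  tangents, and the tangent is integrated. A real factor \<open>\<sigma>\<close>, specialised to \<open>1\<close> or \<open>-1\<close>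
  at the very end, treats the convex and the concave case at once.
\<close>

section \<open>Means with respect to the Gamma distribution\<close>

definition gamma_mean :: "real \<Rightarrow> (real \<Rightarrow> real) \<Rightarrow> real" where
  "gamma_mean m f = integral {0<..} (\<lambda>u. u powr m * exp (- u) * f u) / Gamma (m + 1)"

definition gamma_integrable :: "real \<Rightarrow> (real \<Rightarrow> real) \<Rightarrow> bool" where
  "gamma_integrable m f \<longleftrightarrow> (\<lambda>u. u powr m * exp (- u) * f u) integrable_on {0<..}"

lemma gamma_weight_has_integral:
  fixes m :: real
  assumes "m > -1"
  shows "((\<lambda>u. u powr m * exp (- u)) has_integral Gamma (m + 1)) {0<..}"
proof -
  have "((\<lambda>u. u powr m * exp (- u)) has_integral Gamma (m + 1)) {0..}"
    using Gamma_integral_real[of "m + 1"] assms by (simp add: exp_minus field_simps)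
  moreover have "negligible ({0..} - {0<..} :: real set)"
    by (rule negligible_subset[of "{0}"]) auto
  ultimately show ?thesis
    by (subst has_integral_spike_set_eq[where T = "{0..}"])
       (auto intro: negligible_subset[of "{0::real}"])
qed

lemma gamma_weight_times_id_has_integral:
  fixes m :: real
  assumes "m > -1"
  shows "((\<lambda>u. u powr m * exp (- u) * u) has_integral Gamma (m + 1) * (m + 1)) {0<..}"
proof -
  have "((\<lambda>u. u powr (m + 1) * exp (- u)) has_integral Gamma (m + 1 + 1)) {0<..}"
    using assms by (intro gamma_weight_has_integral) simp
  moreover have "Gamma (m + 1 + 1) = Gamma (m + 1) * (m + 1)"
    using assms Gamma_plus1[of "m + 1"] by (auto simp: nonpos_Ints_def)
  moreover have "u powr (m + 1) * exp (- u) = u powr m * exp (- u) * u" if "u \<in> {0<..}" for u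
    using that by (simp add: powr_add)
  ultimately show ?thesis
    by (metis (no_types, lifting) has_integral_cong)
qed

lemma gamma_mean_cong:
  assumes "\<And>u. u > 0 \<Longrightarrow> f u = g u"
  shows "gamma_integrable m f \<longleftrightarrow> gamma_integrable m g" and "gamma_mean m f = gamma_mean m g"
  unfolding gamma_integrable_def gamma_mean_def
  by (intro integrable_cong arg_cong2[where f = "(/)"] integral_cong refl; simp add: assms)+

lemma gamma_mean_affine:
  assumes "m > -1" "gamma_integrable m h"
  shows "gamma_integrable m (\<lambda>u. A + B * h u)"
    and "gamma_mean m (\<lambda>u. A + B * h u) = A + B * gamma_mean m h"
proof -
  let ?w = "\<lambda>u. u powr m * exp (- u) :: real"
  have "((\<lambda>u. A * ?w u + B * (?w u * h u)) has_integral
          A * Gamma (m + 1) + B * integral {0<..} (\<lambda>u. ?w u * h u)) {0<..}"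
    using assms unfolding gamma_integrable_def
    by (intro has_integral_add has_integral_mult_right gamma_weight_has_integral
          integrable_integral)
  then have *: "((\<lambda>u. ?w u * (A + B * h u)) has_integral
          A * Gamma (m + 1) + B * integral {0<..} (\<lambda>u. ?w u * h u)) {0<..}"
    by (simp add: algebra_simps)
  show "gamma_integrable m (\<lambda>u. A + B * h u)"
    using * unfolding gamma_integrable_def by blast
  have "Gamma (m + 1) > 0"
    using assms by (intro Gamma_real_pos) simp
  then show "gamma_mean m (\<lambda>u. A + B * h u) = A + B * gamma_mean m h"
    using integral_unique[OF *] unfolding gamma_mean_def by (simp add: field_simps)
qed

lemma gamma_mean_mono:
  assumes "m > -1" "gamma_integrable m f" "gamma_integrable m g"
    and "\<And>u. u > 0 \<Longrightarrow> f u \<le> g u"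
  shows "gamma_mean m f \<le> gamma_mean m g"
  using assms Gamma_real_pos[of "m + 1"]
  unfolding gamma_mean_def gamma_integrable_def
  by (intro divide_right_mono integral_le mult_left_mono) auto

lemma gamma_mean_id:
  assumes "m > -1"
  shows "gamma_integrable m (\<lambda>u. u)" and "gamma_mean m (\<lambda>u. u) = m + 1"
proof -
  have "Gamma (m + 1) > 0"
    using assms by (intro Gamma_real_pos) simp
  then show "gamma_integrable m (\<lambda>u. u)" and "gamma_mean m (\<lambda>u. u) = m + 1"
    using gamma_weight_times_id_has_integral[OF assms]
    by (auto simp: gamma_integrable_def gamma_mean_def integral_unique)
qed

lemma gamma_absolutely_integrable_shifted_powr:
  fixes m a b :: real
  assumes "m > -1" "a > 0"
  shows "(\<lambda>u. u powr m * exp (- u) * (a + u) powr b) absolutely_integrable_on {0<..}"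
proof -
  \<comment> \<open>For \<open>b < 0\<close> the last factor is at most \<open>a powr b\<close>. For \<open>b \<ge> 0\<close> it is at most the larger
    of \<open>(2 * a) powr b\<close> and \<open>(2 * u) powr b\<close>; the power of \<open>u\<close> then raises the shape.\<close>
  define C where "C = (if b \<ge> 0 then (2 * a) powr b else a powr b)"
  define D where "D = (if b \<ge> 0 then 2 powr b else 0)"
  define k where "k = (if b \<ge> 0 then b else 0)"
  let ?w = "\<lambda>m u. u powr m * exp (- u) :: real"
  have bound: "(a + u) powr b \<le> C + D * u powr k" if "u > 0" for u
  proof (cases "b \<ge> 0")
    case True
    show ?thesis
    proof (cases "u \<le> a")
      case le: True
      then have "(a + u) powr b \<le> (2 * a) powr b"
        using True assms that by (intro powr_mono2) auto
      then show ?thesis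
        using True by (simp add: C_def D_def k_def add_increasing2)
    next
      case False
      then have "(a + u) powr b \<le> (2 * u) powr b"
        using True assms that by (intro powr_mono2) auto
      then show ?thesis
        using True that by (simp add: C_def D_def k_def powr_mult add_increasing)
    qed
  next
    case False
    then have "(a + u) powr b \<le> a powr b"
      using assms that by (intro powr_mono2') auto
    then show ?thesis
      using False by (simp add: C_def D_def)
  qed
  have int: "(\<lambda>u. C * ?w m u + D * ?w (m + k) u) integrable_on {0<..}"
    using assms
    by (intro integrable_add integrable_on_mult_right
          has_integral_integrable[OF gamma_weight_has_integral]) (auto simp: k_def)
  show ?thesis
  proof (rule measurable_bounded_by_integrable_imp_absolutely_integrable[OF _ _ int])
    have "(\<lambda>u. ?w m u * (a + u) powr b) \<in> borel_measurable borel"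
      by measurable
    then show "(\<lambda>u. ?w m u * (a + u) powr b) \<in> borel_measurable (lebesgue_on {0<..})"
      by (intro measurable_restrict_space1) (simp add: measurable_completion)
  next
    fix u :: real assume "u \<in> {0<..}"
    then have "?w m u * (a + u) powr b \<le> ?w m u * (C + D * u powr k)"
      by (intro mult_left_mono bound) auto
    also have "\<dots> = C * ?w m u + D * ?w (m + k) u"
      by (simp add: powr_add algebra_simps)
    finally show "norm (?w m u * (a + u) powr b) \<le> C * ?w m u + D * ?w (m + k) u"
      by simp
  qed auto
qed

lemma gamma_integrable_shifted_powr:
  assumes "m > -1" "a > 0"
  shows "gamma_integrable m (\<lambda>u. (a + u) powr b)"
  using gamma_absolutely_integrable_shifted_powr[OF assms]
  by (auto simp: gamma_integrable_def absolutely_integrable_on_def)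

lemma gamma_integrable_reciprocal:
  assumes "m > -1" "a > 0"
  shows "gamma_integrable m (\<lambda>u. 1 / (a + u))"
  using gamma_integrable_shifted_powr[OF assms, of "-1"] assms
    gamma_mean_cong(1)[of "\<lambda>u. (a + u) powr (-1)" "\<lambda>u. 1 / (a + u)" m]
  by (simp add: powr_minus_divide)

section \<open>The function \<open>V\<close> as a Gamma mean\<close>

lemma V_eq_gamma_mean:
  assumes "p > 0" "m > -1" "x > 0"
  shows "V m p x = gamma_mean m (\<lambda>u. (x powr p + u) powr ((1 - p) / p))"
proof -
  let ?a = "x powr p"
  define g where "g = (\<lambda>t. t powr p - ?a)"
  define F where "F = (\<lambda>u. u powr m * exp (- u) * (?a + u) powr ((1 - p) / p))"
  define G where "G = (\<lambda>t. (t powr p - ?a) powr m * exp (- (t powr p)))"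
  have a: "?a > 0"
    using assms by simp
  have image: "g ` {x<..} = {0<..}"
  proof (intro equalityI subsetI)
    fix u assume "u \<in> g ` {x<..}"
    then show "u \<in> {0<..}"
      using assms by (auto simp: g_def intro!: powr_less_mono2)
  next
    fix u :: real assume "u \<in> {0<..}"
    then have "?a powr (1 / p) < (?a + u) powr (1 / p)"
      using assms by (intro powr_less_mono2) auto
    then have "(?a + u) powr (1 / p) \<in> {x<..}"
      using assms by (simp add: powr_powr)
    moreover have "g ((?a + u) powr (1 / p)) = u"
      using assms \<open>u \<in> {0<..}\<close> by (simp add: g_def powr_powr)
    ultimately show "u \<in> g ` {x<..}"
      by (metis imageI)
  qed
  have inj: "inj_on g {x<..}"
  proof (rule strict_mono_on_imp_inj_on)
    show "strict_mono_on {x<..} g"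
      using assms by (auto simp: g_def intro!: strict_mono_onI powr_less_mono2)
  qed
  have deriv: "(g has_field_derivative p * t powr (p - 1)) (at t within {x<..})"
    if "t \<in> {x<..}" for t
    unfolding g_def using that assms by (auto intro!: derivative_eq_intros)
  have integrand: "\<bar>p * t powr (p - 1)\<bar> * F (g t) = p * exp ?a * G t" if "t \<in> {x<..}" for t
  proof -
    have "t powr (p - 1) * t powr (p * ((1 - p) / p)) = 1"
      using that assms by (simp flip: powr_add)
    then show ?thesis
      using that assms by (simp add: F_def g_def G_def powr_powr exp_minus exp_diff divide_inverse mult_ac)
  qed
  have "F absolutely_integrable_on g ` {x<..} \<and> integral (g ` {x<..}) F = integral {0<..} F"
    using gamma_absolutely_integrable_shifted_powr[OF \<open>m > -1\<close> a] by (simp add: image F_def)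
  then have "(\<lambda>t. \<bar>p * t powr (p - 1)\<bar> * F (g t)) absolutely_integrable_on {x<..} \<and>
        integral {x<..} (\<lambda>t. \<bar>p * t powr (p - 1)\<bar> * F (g t)) = integral {0<..} F"
    by (subst has_absolute_integral_change_of_variables_1'[OF _ deriv inj]) auto
  then have abs_int: "(\<lambda>t. p * exp ?a * G t) absolutely_integrable_on {x<..}"
    and eq: "integral {x<..} (\<lambda>t. p * exp ?a * G t) = integral {0<..} F"
    using set_integrable_cong[of lebesgue lebesgue "{x<..}" "{x<..}", OF refl refl integrand]
      integral_cong[of "{x<..}", OF integrand] by auto
  have "p * exp ?a * (LBINT t:{x<..}. G t) = (LBINT t:{x<..}. p * exp ?a * G t)"
    by simp
  also have "\<dots> = (LINT t:{x<..}|lebesgue. p * exp ?a * G t)"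
    unfolding set_lebesgue_integral_def G_def by (intro integral_completion[symmetric]) measurable
  also have "\<dots> = integral {x<..} (\<lambda>t. p * exp ?a * G t)"
    by (rule set_lebesgue_integral_eq_integral(2)[OF abs_int])
  also have "\<dots> = integral {0<..} F"
    by (rule eq)
  finally show ?thesis
    unfolding V_def gamma_mean_def F_def G_def by (simp add: field_simps)
qed

section \<open>Jensen's inequality for powers\<close>

lemma powr_tangent:
  fixes b c s \<sigma> :: real
  assumes "0 \<le> \<sigma> * (b * (b - 1))" "c > 0" "s > 0"
  shows "\<sigma> * (c powr b + b * c powr (b - 1) * (s - c)) \<le> \<sigma> * s powr b"
proof -
  have "convex_on {0<..} (\<lambda>s. \<sigma> * s powr b)"
  proof (rule f''_ge0_imp_convex)
    fix s :: real assume s: "s \<in> {0<..}"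
    show "((\<lambda>s. \<sigma> * s powr b) has_real_derivative \<sigma> * (b * s powr (b - 1))) (at s)"
      using s by (auto intro!: derivative_eq_intros)
    show "((\<lambda>s. \<sigma> * (b * s powr (b - 1))) has_real_derivative
            \<sigma> * (b * (b - 1)) * s powr (b - 2)) (at s)"
      using s by (auto intro!: derivative_eq_intros)
    show "0 \<le> \<sigma> * (b * (b - 1)) * s powr (b - 2)"
      by (intro mult_nonneg_nonneg assms(1)) simp
  qed simp
  then have "\<sigma> * s powr b - \<sigma> * c powr b \<ge> \<sigma> * (b * c powr (b - 1)) * (s - c)"
    using assms
    by (intro convex_on_imp_above_tangent[where A = "{0<..}"])
       (auto intro!: derivative_eq_intros simp: interior_open)
  then show ?thesis
    by (simp add: algebra_simps)
qed

text \<open>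
  The tangent point \<open>c\<close> is kept apart from the mean of \<open>h\<close> because for the reciprocal variable
  that mean is only known up to an inequality; the remaining linear term records its effect.
\<close>
lemma gamma_mean_powr_Jensen:
  assumes "0 \<le> \<sigma> * (b * (b - 1))" "c > 0" "m > -1"
    and h: "gamma_integrable m h" "\<And>u. u > 0 \<Longrightarrow> h u > 0"
    and hb: "gamma_integrable m (\<lambda>u. h u powr b)"
  shows "\<sigma> * (c powr b + b * c powr (b - 1) * (gamma_mean m h - c))
           \<le> \<sigma> * gamma_mean m (\<lambda>u. h u powr b)"
proof -
  define A where "A = \<sigma> * (c powr b - b * c powr (b - 1) * c)"
  define B where "B = \<sigma> * (b * c powr (b - 1))"
  have "A + B * gamma_mean m h = gamma_mean m (\<lambda>u. A + B * h u)"
    using assms by (simp add: gamma_mean_affine)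
  also have "\<dots> \<le> gamma_mean m (\<lambda>u. 0 + \<sigma> * h u powr b)"
  proof (intro gamma_mean_mono gamma_mean_affine assms)
    fix u :: real assume "u > 0"
    then show "A + B * h u \<le> 0 + \<sigma> * h u powr b"
      using powr_tangent[OF assms(1,2) h(2)[of u]] by (simp add: A_def B_def algebra_simps)
  qed
  also have "\<dots> = 0 + \<sigma> * gamma_mean m (\<lambda>u. h u powr b)"
    by (intro gamma_mean_affine assms)
  finally show ?thesis
    by (simp add: A_def B_def algebra_simps)
qed

text \<open>
  For \<open>m > 0\<close> this is Jensen's inequality for the concave function \<open>u / (a + u)\<close>, whose tangent
  at the mean \<open>m\<close> of the Gamma distribution of shape \<open>m\<close> is \<open>m / (a + m) + a * (u - m) / (a + m)\<^sup>2\<close>.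
\<close>
lemma gamma_mean_reciprocal_le:
  assumes "m \<ge> 0" "a > 0"
  shows "gamma_mean m (\<lambda>u. 1 / (a + u)) \<le> 1 / (a + m)"
proof (cases "m = 0")
  case True
  have const: "gamma_integrable 0 (\<lambda>u. 1 / a + 0 * u)"
    "gamma_mean 0 (\<lambda>u. 1 / a + 0 * u) = 1 / a + 0 * gamma_mean 0 (\<lambda>u. u)"
    by (intro gamma_mean_affine gamma_mean_id; simp)+
  have "gamma_mean 0 (\<lambda>u. 1 / (a + u)) \<le> gamma_mean 0 (\<lambda>u. 1 / a + 0 * u)"
    using assms by (intro gamma_mean_mono gamma_integrable_reciprocal const) (auto simp: field_simps)
  then show ?thesis
    using True const(2) by simp
next
  case False
  then have m: "m > 0"
    using assms by simp
  have shift: "u powr m * exp (- u) * (1 / (a + u)) = u powr (m - 1) * exp (- u) * (u / (a + u))"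
    if "u > 0" for u
    using that by (simp add: powr_diff)
  have "gamma_integrable m (\<lambda>u. 1 / (a + u))"
    using assms by (intro gamma_integrable_reciprocal) auto
  then have int: "gamma_integrable (m - 1) (\<lambda>u. u / (a + u))"
    unfolding gamma_integrable_def by (rule integrable_eq) (use shift in simp)
  define A where "A = m / (a + m) - a * m / (a + m)\<^sup>2"
  define B where "B = a / (a + m)\<^sup>2"
  have "gamma_mean (m - 1) (\<lambda>u. u / (a + u)) \<le> gamma_mean (m - 1) (\<lambda>u. A + B * u)"
  proof (intro gamma_mean_mono int gamma_mean_affine gamma_mean_id)
    fix u :: real assume u: "u > 0"
    have "A + B * u - u / (a + u) = a * (u - m)\<^sup>2 / ((a + m)\<^sup>2 * (a + u))"
      using u m assms unfolding A_def B_def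
      by (simp add: divide_simps) (simp add: power2_eq_square algebra_simps)
    also have "\<dots> \<ge> 0"
      using u assms by simp
    finally show "u / (a + u) \<le> A + B * u"
      by simp
  qed (use m in auto)
  also have "\<dots> = A + B * (m - 1 + 1)"
    using m by (simp only: gamma_mean_affine gamma_mean_id)
  also have "\<dots> = m / (a + m)"
    by (simp add: A_def B_def)
  finally have le: "gamma_mean (m - 1) (\<lambda>u. u / (a + u)) \<le> m / (a + m)" .
  have "integral {0<..} (\<lambda>u. u powr m * exp (- u) * (1 / (a + u)))
      = integral {0<..} (\<lambda>u. u powr (m - 1) * exp (- u) * (u / (a + u)))"
    using shift by (intro integral_cong) auto
  moreover have "Gamma (m + 1) = m * Gamma m"
    using m by (intro Gamma_plus1) (auto simp: nonpos_Ints_def)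
  ultimately have "gamma_mean m (\<lambda>u. 1 / (a + u)) = gamma_mean (m - 1) (\<lambda>u. u / (a + u)) / m"
    unfolding gamma_mean_def by simp
  also have "\<dots> \<le> m / (a + m) / m"
    using le m by (intro divide_right_mono) auto
  finally show ?thesis
    using m by simp
qed

section \<open>Bounds for \<open>V\<close>\<close>

lemma V_bound_mean:
  fixes p :: real
  defines "b \<equiv> (1 - p) / p"
  assumes "0 \<le> \<sigma> * (b * (b - 1))" "p > 0" "m > -1" "x > 0"
  shows "\<sigma> * (x powr p + m + 1) powr b \<le> \<sigma> * V m p x"
proof -
  let ?a = "x powr p"
  have a: "?a > 0"
    using assms by simp
  have "gamma_mean m (\<lambda>u. ?a + 1 * u) = ?a + 1 * (m + 1)"
    using assms by (simp only: gamma_mean_affine gamma_mean_id)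
  moreover have "gamma_integrable m (\<lambda>u. ?a + 1 * u)"
    using assms by (intro gamma_mean_affine gamma_mean_id)
  ultimately show ?thesis
    using gamma_mean_powr_Jensen[of \<sigma> b "?a + m + 1" m "\<lambda>u. ?a + u"] assms a
      gamma_integrable_shifted_powr[of m ?a b]
    by (simp add: V_eq_gamma_mean add_pos_pos algebra_simps)
qed

text \<open>
  In the reciprocal variable the exponent is \<open>- b\<close>, with curvature factor \<open>b * (b + 1) = b / p\<close>,
  so a single sign condition on \<open>b\<close> settles both whether this power is convex or concave and whether it is
  decreasing or increasing.
\<close>
lemma V_bound_reciprocal_mean:
  fixes p :: real
  defines "b \<equiv> (1 - p) / p"
  assumes "0 \<le> \<sigma> * b" "p > 0" "m \<ge> 0" "x > 0"
  shows "\<sigma> * (x powr p + m) powr b \<le> \<sigma> * V m p x"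
proof -
  let ?a = "x powr p"
  define c where "c = 1 / (?a + m)"
  define \<mu> where "\<mu> = gamma_mean m (\<lambda>u. 1 / (?a + u))"
  have a: "?a > 0" and c: "c > 0"
    using assms by (auto simp: c_def add_pos_nonneg)
  have "b + 1 > 0"
    using assms(3) by (simp add: b_def field_simps)
  then have "0 \<le> (\<sigma> * b) * (b + 1)"
    using assms(2) by (intro mult_nonneg_nonneg[of "\<sigma> * b"]) auto
  then have curv: "0 \<le> \<sigma> * (- b * (- b - 1))"
    by (simp add: algebra_simps)
  have int: "gamma_integrable m (\<lambda>u. 1 / (?a + u))"
    using assms a by (intro gamma_integrable_reciprocal) auto
  have recip: "(1 / s) powr (- b) = s powr b" if "s > 0" for s
    using that by (simp add: powr_minus powr_divide field_simps)
  have recip_shifted: "(1 / (?a + u)) powr (- b) = (?a + u) powr b" if "u > 0" for u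
    by (intro recip add_pos_pos a that)
  have intb: "gamma_integrable m (\<lambda>u. (1 / (?a + u)) powr (- b))"
    using assms a gamma_integrable_shifted_powr[of m ?a b]
    by (subst gamma_mean_cong(1)[OF recip_shifted]) auto
  have "0 \<le> (\<sigma> * b) * (c powr (- b - 1) * (c - \<mu>))"
    using gamma_mean_reciprocal_le[OF \<open>m \<ge> 0\<close> a] assms(2)
    by (intro mult_nonneg_nonneg[of "\<sigma> * b"] mult_nonneg_nonneg[of "c powr (- b - 1)"])
       (auto simp: c_def \<mu>_def)
  then have "\<sigma> * c powr (- b) \<le> \<sigma> * (c powr (- b) + - b * c powr (- b - 1) * (\<mu> - c))"
    by (simp add: algebra_simps)
  also have "\<dots> \<le> \<sigma> * gamma_mean m (\<lambda>u. (1 / (?a + u)) powr (- b))"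
    unfolding \<mu>_def using assms a
    by (intro gamma_mean_powr_Jensen curv c int intb) (auto intro: add_pos_pos)
  also have "gamma_mean m (\<lambda>u. (1 / (?a + u)) powr (- b)) = gamma_mean m (\<lambda>u. (?a + u) powr b)"
    by (rule gamma_mean_cong(2)[OF recip_shifted])
  also have "\<dots> = V m p x"
    using assms by (simp add: V_eq_gamma_mean)
  finally show ?thesis
    using recip[of "?a + m"] a assms by (simp add: c_def)
qed

theorem proposition4:
  fixes p x :: real
  assumes "x > 0"
  shows "(p > 1 \<longrightarrow>
           (\<forall>m > -1. V m p x \<ge> (x powr p + m + 1) powr (- ((p - 1) / p))) \<and>
           (\<forall>m \<ge> 0. V m p x \<le> (x powr p + m) powr (- ((p - 1) / p)))) \<and>
         (1 / 2 \<le> p \<and> p < 1 \<longrightarrow>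
           (\<forall>m > -1. V m p x \<le> (x powr p + m + 1) powr ((1 - p) / p)) \<and>
           (\<forall>m \<ge> 0. V m p x \<ge> (x powr p + m) powr ((1 - p) / p))) \<and>
         (0 < p \<and> p \<le> 1 / 2 \<longrightarrow>
           (\<forall>m > -1. V m p x \<ge> (x powr p + m + 1) powr ((1 - p) / p)))"
proof (intro conjI impI allI)
  let ?b = "(1 - p) / p"
  have neg: "- ((p - 1) / p) = ?b"
    by (simp add: minus_divide_left)
  {
    assume p: "p > 1"
    then have b: "?b \<le> 0"
      by (simp add: divide_simps)
    fix m :: real
    show "V m p x \<ge> (x powr p + m + 1) powr (- ((p - 1) / p))" if "m > -1"
      using V_bound_mean[of 1 p m x] p b that assms
      by (simp add: neg mult_nonpos_nonpos)
    show "V m p x \<le> (x powr p + m) powr (- ((p - 1) / p))" if "m \<ge> 0"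
      using V_bound_reciprocal_mean[of "-1" p m x] p b that assms by (simp add: neg)
  next
    assume p: "1 / 2 \<le> p \<and> p < 1"
    then have b: "0 \<le> ?b" "?b \<le> 1"
      by (auto simp: divide_simps)
    fix m :: real
    show "V m p x \<le> (x powr p + m + 1) powr ?b" if "m > -1"
      using V_bound_mean[of "-1" p m x] p mult_nonneg_nonpos[of ?b "?b - 1"] b that assms by simp
    show "V m p x \<ge> (x powr p + m) powr ?b" if "m \<ge> 0"
      using V_bound_reciprocal_mean[of 1 p m x] p b that assms by simp
  next
    assume p: "0 < p \<and> p \<le> 1 / 2"
    then have b: "1 \<le> ?b"
      by (auto simp: divide_simps)
    fix m :: real
    show "V m p x \<ge> (x powr p + m + 1) powr ?b" if "m > -1"
      using V_bound_mean[of 1 p m x] p mult_nonneg_nonneg[of ?b "?b - 1"] b that assms by simp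
  }
qed

end
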